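(* Let $d_{\rm sd},\epsilon,\delta>0$ with $\delta\le d_{\rm sd}/\epsilon-\delta$. The optimal solutions of the RIS placement problem for the elliptical topology, $$\min_{d}\ Z_e(d)=d^2\left(\frac{d_{\rm sd}}{\epsilon}-d\right)^2\quad\text{subject to}\quad d\ge\delta,\quad d\le\frac{d_{\rm sd}}{\epsilon}-\delta,$$ are $d^\star\in\left\{\delta,\ \frac{d_{\rm sd}}{\epsilon}-\delta\right\}$.
   Context: Here $d$ is the real optimization variable (source–RIS distance), $d_{\rm sd}$ is the distance between the D2D source and destination located at the foci of an ellipse with eccentricity $\epsilon$, and $\delta$ is the minimal allowed distance between the RIS and either node. *)

theory Defs
  imports Complex_Main
begin

text \<open>
  On an ellipse with eccentricity \<open>\<epsilon>\<close> and foci at distance \<open>d_sd\<close>, the two focal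
  distances of a point sum to the major axis \<open>d_sd / \<epsilon>\<close>.  So an RIS at distance \<open>d\<close>
  from the source is at distance \<open>d_sd / \<epsilon> - d\<close> from the destination.
\<close>

definition Z_e :: "real \<Rightarrow> real \<Rightarrow> real \<Rightarrow> real" where
  "Z_e d_sd \<epsilon> d = d\<^sup>2 * (d_sd / \<epsilon> - d)\<^sup>2"

definition ris_feasible :: "real \<Rightarrow> real \<Rightarrow> real \<Rightarrow> real \<Rightarrow> bool" where
  "ris_feasible d_sd \<epsilon> \<delta> d \<longleftrightarrow> d \<ge> \<delta> \<and> d \<le> d_sd / \<epsilon> - \<delta>"

definition ris_optimal_solutions :: "real \<Rightarrow> real \<Rightarrow> real \<Rightarrow> real set" where
  "ris_optimal_solutions d_sd \<epsilon> \<delta> =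
    {d. is_arg_min (Z_e d_sd \<epsilon>) (ris_feasible d_sd \<epsilon> \<delta>) d}"

end

(* With L = d_sd / \<epsilon>, the product of focal distances satisfies
   d (L - d) - \<delta> (L - \<delta>) = (d - \<delta>) (L - \<delta> - d), which is nonnegative on the feasible
   interval and vanishes exactly at its endpoints; squaring preserves this. *)
theory Submission
  imports Defs
begin

text \<open>Difference of squares: with \<open>a = d * (d_sd / \<epsilon> - d)\<close> and
  \<open>b = \<delta> * (d_sd / \<epsilon> - \<delta>)\<close>, the first two factors multiply to
  \<open>a - b\<close> and the last is \<open>a + b\<close>.\<close>

lemma Z_e_minus_Z_e_endpoint:
  "Z_e d_sd \<epsilon> d - Z_e d_sd \<epsilon> \<delta> =
    (d - \<delta>) * (d_sd / \<epsilon> - \<delta> - d) * (d * (d_sd / \<epsilon> - d) + \<delta> * (d_sd / \<epsilon> - \<delta>))"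
  unfolding Z_e_def by algebra

text \<open>Feasibility keeps both focal distances at least \<delta>. Strictness matters: the sum
  factor then contributes no zeros beyond the two endpoints.\<close>

lemma ris_feasible_imp_product_sum_pos:
  assumes "\<delta> > 0" and "ris_feasible d_sd \<epsilon> \<delta> d"
  shows "d * (d_sd / \<epsilon> - d) + \<delta> * (d_sd / \<epsilon> - \<delta>) > 0"
proof -
  have "d > 0" "d_sd / \<epsilon> - d > 0" "d_sd / \<epsilon> - \<delta> > 0"
    using assms unfolding ris_feasible_def by linarith+
  then show ?thesis
    using \<open>\<delta> > 0\<close> by (intro add_pos_pos mult_pos_pos)
qed

lemma Z_e_endpoint_le:
  assumes "\<delta> > 0" and "ris_feasible d_sd \<epsilon> \<delta> d"
  shows "Z_e d_sd \<epsilon> \<delta> \<le> Z_e d_sd \<epsilon> d"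
proof -
  have "0 \<le> d - \<delta>" "0 \<le> d_sd / \<epsilon> - \<delta> - d"
    using assms(2) unfolding ris_feasible_def by linarith+
  then have "0 \<le> Z_e d_sd \<epsilon> d - Z_e d_sd \<epsilon> \<delta>"
    unfolding Z_e_minus_Z_e_endpoint
    using ris_feasible_imp_product_sum_pos[OF assms] by (intro mult_nonneg_nonneg) simp_all
  then show ?thesis by simp
qed

lemma Z_e_eq_endpoint_iff:
  assumes "\<delta> > 0" and "ris_feasible d_sd \<epsilon> \<delta> d"
  shows "Z_e d_sd \<epsilon> d = Z_e d_sd \<epsilon> \<delta> \<longleftrightarrow> d = \<delta> \<or> d = d_sd / \<epsilon> - \<delta>"
proof -
  have "Z_e d_sd \<epsilon> d = Z_e d_sd \<epsilon> \<delta> \<longleftrightarrow> Z_e d_sd \<epsilon> d - Z_e d_sd \<epsilon> \<delta> = 0"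
    by simp
  also have "\<dots> \<longleftrightarrow> d - \<delta> = 0 \<or> d_sd / \<epsilon> - \<delta> - d = 0"
    unfolding Z_e_minus_Z_e_endpoint mult_eq_0_iff
    using ris_feasible_imp_product_sum_pos[OF assms] by linarith
  finally show ?thesis by auto
qed

theorem mainTheorem6:
  fixes d_sd \<epsilon> \<delta> :: real
  assumes "d_sd > 0" and "\<epsilon> > 0" and "\<delta> > 0"
    and "\<delta> \<le> d_sd / \<epsilon> - \<delta>"
  shows "ris_optimal_solutions d_sd \<epsilon> \<delta> = {\<delta>, d_sd / \<epsilon> - \<delta>}"
proof -
  have feasible: "ris_feasible d_sd \<epsilon> \<delta> \<delta>" "ris_feasible d_sd \<epsilon> \<delta> (d_sd / \<epsilon> - \<delta>)"
    using assms(4) by (simp_all add: ris_feasible_def)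
  \<comment> \<open>Since \<delta> is feasible and attains the minimum, the minimizers are exactly
    the feasible points sharing its value.\<close>
  have "is_arg_min (Z_e d_sd \<epsilon>) (ris_feasible d_sd \<epsilon> \<delta>) d \<longleftrightarrow>
      ris_feasible d_sd \<epsilon> \<delta> d \<and> Z_e d_sd \<epsilon> d = Z_e d_sd \<epsilon> \<delta>" for d
    unfolding is_arg_min_linorder
    using Z_e_endpoint_le[OF \<open>\<delta> > 0\<close>] feasible(1) by (metis order_antisym)
  \<comment> \<open>The equality criterion presupposes feasibility, so the converse direction uses
    that both endpoints are feasible.\<close>
  then have "is_arg_min (Z_e d_sd \<epsilon>) (ris_feasible d_sd \<epsilon> \<delta>) d \<longleftrightarrow> d \<in> {\<delta>, d_sd / \<epsilon> - \<delta>}" for d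
    using Z_e_eq_endpoint_iff[OF \<open>\<delta> > 0\<close>] feasible by blast
  then show ?thesis
    unfolding ris_optimal_solutions_def by blast
qed

end
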